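(* Let $P$ be a (finite) polyhedral complex, and suppose that each maximal cell of $P$ is provided as vertex-facet incidences with possibly marked face at infinity. Then the algorithm FaceIterator can be applied to visit exactly once each element in $P$.
   Context: A polyhedral complex is a collection of polyhedra closed under taking faces such that the intersection of any two is a face of both. The face lattice of a polyhedron is isomorphic to the one obtained by quotienting out the affine space it contains, so one can assume that a polyhedron contains no affine line; if it is then unbounded, one may add an extra face at infinity (the marked face) to obtain a projectively equivalent polytope, and the faces of the polyhedron are exactly the faces of this polytope not contained in the marked face (together with the empty face). Faces are identified with sets of vertices, including vertices at infinity. "Can be applied" refers to successive application to the maximal cells: if $L_1,\dots,L_k$ are finite locally branched meet semi-sublattices of the lattice of subsets of $\{1,\dots,n\}$ (locally branched: for every saturated chain $x\prec y\prec z$ there is $w\neq y$ with $x<w<z$), one iterates through all elements of their union by first iterating through $L_1$, then through all elements of $L_2$ not contained in $L_1$, and so on. Here the $L_i$ are the face lattices of the maximal cells. The algorithm may be assumed to additionally visit the upper bound of a lattice (here, the maximal cell itself) whenever this is suitable. "Visit" means "output". Algorithm FaceIterator$(C,I,J)$, where $I$ is a list of subsets of $\{1,\dots,n\}$ (ignored sets), $J\subseteq\{1,\dots,n\}$ (ignored atoms), and $C$ is the list of coatoms of the lattice not contained in any element of $I$. If $C$ is empty, stop. Otherwise: 1. Let $a$ be the first element of $C$. 2. If $a\cap J=\emptyset$, output $a$. 3. Let $N_1=\{a\cap b : b\in C,\ b\neq a\}$, let $N_2=\{x\in N_1 : x\not\subseteq y \text{ for all } y\in I\}$, and let $N$ be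 the list (without repetitions) of inclusion-maximal elements of $N_2$. 4. Call FaceIterator$(N, I, J)$ with a copy of $I$ (so that later changes made to $I$ inside this call do not affect the current $I$). 5. Let $C'=\{x\in C : x\not\subseteq a\cup J\}$ and append $a\cup J$ to $I$. 6. Call FaceIterator$(C', I, J)$. *)

theory Defs
  imports "HOL-Analysis.Analysis"
begin

definition polyhedral_complex :: "'a::euclidean_space set set \<Rightarrow> bool" where
  "polyhedral_complex \<P> \<longleftrightarrow>
     (\<forall>P\<in>\<P>. polyhedron P) \<and>
     (\<forall>P\<in>\<P>. \<forall>F. F face_of P \<longrightarrow> F \<in> \<P>) \<and>
     (\<forall>P\<in>\<P>. \<forall>Q\<in>\<P>. (P \<inter> Q) face_of P \<and> (P \<inter> Q) face_of Q)"

definition maximal_cells :: "'a set set \<Rightarrow> 'a set set" where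
  "maximal_cells \<P> = {P \<in> \<P>. \<forall>Q\<in>\<P>. P \<subseteq> Q \<longrightarrow> Q = P}"

text \<open>
  The projective completion of a polyhedron is handled in homogeneous coordinates. For a nonempty
  polyhedron \<open>P\<close> the cone below has lineality space (lineality space of \<open>P\<close>) \<open>\<times> {0}\<close>; modulo that
  space it is pointed, and its sections transversal to all of its rays are the polytopes
  projectively equivalent to the line-free quotient of \<open>P\<close>, completed by the points at infinity
  (those with last coordinate \<open>0\<close>). Hence faces of this polytope are nonempty faces of the cone: its
  facets are the facets of the cone, its vertices are the faces one dimension above the lineality
  space, and its empty face is the lineality space itself. In particular the completion of a
  single point, and of an affine subspace, has the empty face as its only facet. A vertex is the
  same set for every polyhedron having it as a vertex, also if it lies at infinity.
\<close>

definition homog_cone :: "'a::euclidean_space set \<Rightarrow> ('a \<times> real) set" where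
  "homog_cone P = closure (cone hull (P \<times> {1}))"

definition lineality_space :: "'b::euclidean_space set \<Rightarrow> 'b set" where
  "lineality_space K = K \<inter> uminus ` K"

definition cone_vertices :: "'b::euclidean_space set \<Rightarrow> 'b set set" where
  "cone_vertices K = {R. R face_of K \<and> aff_dim R = aff_dim (lineality_space K) + 1}"

definition vertices_of :: "'a::euclidean_space set \<Rightarrow> ('a \<times> real) set set" where
  "vertices_of P = cone_vertices (homog_cone P)"

definition vertices_at_infinity :: "'a::euclidean_space set \<Rightarrow> ('a \<times> real) set set" where
  "vertices_at_infinity P = cone_vertices (homog_cone P \<inter> {z. snd z = 0})"

datatype cell_data =
  Cell_Data (cell_vertices: "nat set") (cell_facets: "nat set list") (cell_marked: "nat set option")

text \<open>
  Vertices are labelled by natural numbers through \<open>lab\<close>. The facets are those of the projectively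
  equivalent polytope, so the face at infinity is among them if it is a facet. There is no marked
  face if \<open>P\<close> is bounded up to its lineality space.
\<close>

definition presents ::
    "(('a::euclidean_space \<times> real) set \<Rightarrow> nat) \<Rightarrow> 'a set \<Rightarrow> cell_data \<Rightarrow> bool" where
  "presents lab P d \<longleftrightarrow>
     cell_vertices d = lab ` vertices_of P \<and>
     distinct (cell_facets d) \<and>
     set (cell_facets d) = {lab ` cone_vertices G | G. G facet_of homog_cone P} \<and>
     cell_marked d =
       (if vertices_at_infinity P = {} then None else Some (lab ` vertices_at_infinity P))"

definition next_coatoms :: "nat set \<Rightarrow> nat set list \<Rightarrow> nat set list \<Rightarrow> nat set set" where
  "next_coatoms a C I =
     (let N1 = {a \<inter> b | b. b \<in> set C \<and> b \<noteq> a};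
          N2 = {x \<in> N1. \<forall>y\<in>set I. \<not> x \<subseteq> y}
      in {x \<in> N2. \<forall>y\<in>N2. x \<subseteq> y \<longrightarrow> y = x})"

text \<open>
  \<open>face_iterator C I J out\<close>: some run of the algorithm on \<open>C\<close>, \<open>I\<close>, \<open>J\<close> outputs exactly the sequence
  \<open>out\<close>. The algorithm does not specify the order of the list \<open>N\<close>; every order is admitted.
\<close>

inductive face_iterator ::
    "nat set list \<Rightarrow> nat set list \<Rightarrow> nat set \<Rightarrow> nat set list \<Rightarrow> bool" where
  stop: "face_iterator [] I J []"
| step: "face_iterator (a # C) I J ((if a \<inter> J = {} then [a] else []) @ out1 @ out2)"
    if "set N = next_coatoms a (a # C) I" and "distinct N"
    and "face_iterator N I J out1"
    and "C' = filter (\<lambda>x. \<not> x \<subseteq> a \<union> J) (a # C)"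
    and "face_iterator C' (I @ [a \<union> J]) J out2"

text \<open>Both recursive calls shorten the first argument, so there are no infinite runs.\<close>

lemma face_iterator_calls_shorter:
  shows "set N = next_coatoms a (a # C) I \<Longrightarrow> distinct N \<Longrightarrow> length N < length (a # C)"
    and "length (filter (\<lambda>x. \<not> x \<subseteq> a \<union> J) (a # C)) < length (a # C)"
proof -
  assume N: "set N = next_coatoms a (a # C) I" "distinct N"
  have "set N \<subseteq> (\<inter>) a ` set C"
    unfolding N(1) next_coatoms_def by (auto simp: Let_def)
  then have "card (set N) \<le> card (set C)"
    by (rule surj_card_le[rotated]) simp
  also have "\<dots> \<le> length C"
    by (rule card_length)
  finally show "length N < length (a # C)"
    using distinct_card[OF N(2)] by simp
next
  show "length (filter (\<lambda>x. \<not> x \<subseteq> a \<union> J) (a # C)) < length (a # C)"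
    by (simp add: le_imp_less_Suc)
qed

text \<open>
  Successive application to a list of cells: the first argument collects the vertex sets of the
  cells already treated. A nonempty face of the current cell, not at infinity, belongs to an
  earlier cell iff its vertex set is contained in that of the earlier cell, so these vertex sets serve as ignored sets, together
  with the marked face of the current cell. The upper bound, the cell itself, is visited first.
\<close>

inductive visit_cells :: "nat set list \<Rightarrow> cell_data list \<Rightarrow> nat set list \<Rightarrow> bool" where
  nil: "visit_cells V [] []"
| cons: "visit_cells V (d # ds) (cell_vertices d # out1 @ out2)"
    if "I = V @ (case cell_marked d of None \<Rightarrow> [] | Some m \<Rightarrow> [m])"
    and "C = filter (\<lambda>a. \<forall>y\<in>set I. \<not> a \<subseteq> y) (cell_facets d)"
    and "face_iterator C I {} out1"
    and "visit_cells (V @ [cell_vertices d]) ds out2"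

text \<open>
  The faces of a polyhedron with marked face are the faces of the completed polytope not contained
  in the marked face, together with the empty face. So if the first cell has a marked face, its
  empty face has to be added; for later cells the empty face has already been visited.
\<close>

definition visit_complex :: "cell_data list \<Rightarrow> nat set list \<Rightarrow> bool" where
  "visit_complex ds out \<longleftrightarrow>
     (\<exists>out'. visit_cells [] ds out' \<and>
        out = out' @ (if ds \<noteq> [] \<and> cell_marked (hd ds) \<noteq> None then [{}] else []))"

end

theory Submission
  imports Defs
begin

text \<open>
  Sending a face of a polyhedral cone to the set of its vertices embeds the face lattice into a
  lattice of sets. Every proper face is the intersection of the facets containing it, so this
  lattice is locally branched. Local branching makes the maximal intersections \<open>a \<inter> b\<close> with the
  other coatoms \<open>b\<close> exactly the coatoms below \<open>a\<close> that are not ignored, so the iterator visits the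
  elements below \<open>a\<close> in its first recursive call and the remaining ones in its second.

  For a cell \<open>P\<close>, the faces of its homogenization not contained in the hyperplane at infinity are the
  homogenizations of the nonempty faces of \<open>P\<close>. Vertex sets detect inclusion even across cells: if
  the vertices of \<open>F \<noteq> {}\<close> are vertices of \<open>Q\<close>, then \<open>F\<close> and \<open>Q\<close> share a finite vertex, hence meet, so
  the cone of \<open>F \<inter> Q\<close> is the intersection of the cones and contains all vertices of \<open>F\<close>. Therefore
  ignoring the earlier cells and the marked face leaves precisely the faces not visited before.
\<close>

section \<open>The iterator on locally branched lattices of sets\<close>

definition coatoms_below :: "'a set set \<Rightarrow> 'a set \<Rightarrow> 'a set set" where
  "coatoms_below L t = {x \<in> L. x \<subset> t \<and> (\<forall>y\<in>L. x \<subset> y \<longrightarrow> \<not> y \<subset> t)}"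

lemma coatom_above:
  assumes "finite L" "x \<in> L" "x \<subset> t"
  obtains a where "a \<in> coatoms_below L t" "x \<subseteq> a"
proof -
  let ?U = "{y \<in> L. x \<subseteq> y \<and> y \<subset> t}"
  have U: "finite ?U" "?U \<noteq> {}" using assms by auto
  obtain a where a: "a \<in> ?U" "\<forall>y\<in>?U. a \<subseteq> y \<longrightarrow> a = y"
    using finite_has_maximal[OF U] by (elim bexE)
  then have "a \<in> coatoms_below L t"
    unfolding coatoms_below_def by auto
  moreover have "x \<subseteq> a" using a(1) by simp
  ultimately show thesis by (rule that)
qed

text \<open>The nested \<open>coatoms_below\<close> express a saturated chain: \<open>y\<close> is
  covered by \<open>z\<close>, and \<open>x\<close> by \<open>y\<close>.\<close>

definition locally_branched :: "'a set set \<Rightarrow> bool" where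
  "locally_branched L \<longleftrightarrow>
     (\<forall>z\<in>L. \<forall>y\<in>coatoms_below L z. \<forall>x\<in>coatoms_below L y. \<exists>w\<in>L. w \<noteq> y \<and> x \<subset> w \<and> w \<subset> z)"

text \<open>A coatom \<open>x\<close> of \<open>a\<close> is an intersection
  \<open>a \<inter> b\<close> because local branching offers a second way up from \<open>x\<close>
  to \<open>t\<close>. Conversely, every candidate lies strictly below \<open>a\<close>, hence under
  a coatom of \<open>a\<close>, which is itself a candidate; so maximal candidates are
  coatoms.\<close>

lemma next_coatoms_eq:
  assumes L: "finite L" "\<And>x y. x \<in> L \<Longrightarrow> y \<in> L \<Longrightarrow> x \<inter> y \<in> L" "locally_branched L"
    and "t \<in> L" and C: "set C = {x \<in> coatoms_below L t. \<forall>y\<in>set I. \<not> x \<subseteq> y}"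
    and a: "a \<in> set C"
  shows "next_coatoms a C I = {x \<in> coatoms_below L a. \<forall>y\<in>set I. \<not> x \<subseteq> y}"
proof -
  define N2 where "N2 = {x \<in> {a \<inter> b | b. b \<in> set C \<and> b \<noteq> a}. \<forall>y\<in>set I. \<not> x \<subseteq> y}"
  have N: "next_coatoms a C I = {x \<in> N2. \<forall>y\<in>N2. x \<subseteq> y \<longrightarrow> y = x}"
    by (simp add: next_coatoms_def N2_def Let_def)
  have aL: "a \<in> L" "a \<in> coatoms_below L t" using a C by (auto simp: coatoms_below_def)
  have below: "x \<in> L \<and> x \<subset> a \<and> (\<forall>y\<in>set I. \<not> x \<subseteq> y)" if "x \<in> N2" for x
  proof -
    from that obtain b where b: "x = a \<inter> b" "b \<in> set C" "b \<noteq> a" "\<forall>y\<in>set I. \<not> x \<subseteq> y"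
      by (auto simp: N2_def)
    then have bL: "b \<in> L" "b \<in> coatoms_below L t" using C by (auto simp: coatoms_below_def)
    then have "\<not> a \<subset> b" using aL by (auto simp: coatoms_below_def)
    with b bL aL L(2) show ?thesis by blast
  qed
  have mem: "x \<in> N2" if x: "x \<in> coatoms_below L a" "\<forall>y\<in>set I. \<not> x \<subseteq> y" for x
  proof -
    \<comment> \<open>Local branching applied to \<open>x\<close>, \<open>a\<close>,
      \<open>t\<close> gives \<open>w\<close>. A coatom \<open>b\<close> of \<open>t\<close> above
      \<open>w\<close> differs from \<open>a\<close>, as otherwise \<open>w\<close> would lie
      strictly between \<open>x\<close> and \<open>a\<close>.\<close>
    obtain w where w: "w \<in> L" "w \<noteq> a" "x \<subset> w" "w \<subset> t"
      using bspec[OF bspec[OF bspec[OF L(3)[unfolded locally_branched_def] \<open>t \<in> L\<close>] aL(2)] x(1)] by auto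
    obtain b where b: "b \<in> coatoms_below L t" "w \<subseteq> b"
      using coatom_above[OF L(1) w(1,4)] by blast
    have "b \<noteq> a" using x w b(2) by (auto simp: coatoms_below_def)
    have xb: "x \<subseteq> a \<inter> b" using x w b by (auto simp: coatoms_below_def)
    have "\<not> a \<subset> b" using aL b by (auto simp: coatoms_below_def)
    then have "a \<inter> b \<subset> a" using \<open>b \<noteq> a\<close> by blast
    moreover have "a \<inter> b \<in> L" using aL b L(2) by (auto simp: coatoms_below_def)
    ultimately have eq: "x = a \<inter> b" using x(1) xb by (auto simp: coatoms_below_def)
    have "\<forall>y\<in>set I. \<not> b \<subseteq> y" using xb x(2) by (meson le_inf_iff order_trans)
    then have "b \<in> set C" using C b(1) by simp
    then show ?thesis unfolding N2_def using x(2) eq \<open>b \<noteq> a\<close> by blast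
  qed
  show ?thesis
  proof (intro equalityI subsetI)
    fix x assume "x \<in> next_coatoms a C I"
    then have x: "x \<in> N2" "\<And>y. y \<in> N2 \<Longrightarrow> x \<subseteq> y \<Longrightarrow> y = x" by (auto simp: N)
    note bx = below[OF x(1)]
    obtain c where c: "c \<in> coatoms_below L a" "x \<subseteq> c"
      using coatom_above[OF L(1)] bx by blast
    have "c \<in> N2" using mem[OF c(1)] c(2) bx by (meson order_trans)
    then have "c = x" using x(2) c(2) by blast
    with c bx show "x \<in> {x \<in> coatoms_below L a. \<forall>y\<in>set I. \<not> x \<subseteq> y}" by simp
  next
    fix x assume x: "x \<in> {x \<in> coatoms_below L a. \<forall>y\<in>set I. \<not> x \<subseteq> y}"
    have "y = x" if "y \<in> N2" "x \<subseteq> y" for y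
      using below[OF that(1)] that(2) x by (auto simp: coatoms_below_def)
    with x mem show "x \<in> next_coatoms a C I" by (auto simp: N)
  qed
qed

text \<open>Induction over the run with varying top \<open>t\<close>: the first recursive call has
  top \<open>a\<close>, the second keeps \<open>t\<close> and ignores \<open>a\<close>. The elements
  below \<open>t\<close> split into \<open>a\<close>, those strictly below \<open>a\<close>, and
  those not contained in \<open>a\<close>.\<close>

theorem face_iterator_visits_once:
  assumes "face_iterator C I J out" "J = {}"
    and L: "finite L" "\<And>x y. x \<in> L \<Longrightarrow> y \<in> L \<Longrightarrow> x \<inter> y \<in> L" "locally_branched L"
    and "t \<in> L" "set C = {x \<in> coatoms_below L t. \<forall>y\<in>set I. \<not> x \<subseteq> y}"
  shows "distinct out \<and> set out = {x \<in> L. x \<subset> t \<and> (\<forall>y\<in>set I. \<not> x \<subseteq> y)}"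
  using assms(1,2,6,7)
proof (induction arbitrary: t rule: face_iterator.induct)
  case (stop I J)
  \<comment> \<open>With no coatom left in the list, every \<open>x\<close> below \<open>t\<close>
    lies under an ignored coatom.\<close>
  have "\<exists>y\<in>set I. x \<subseteq> y" if x: "x \<in> L" "x \<subset> t" for x
  proof -
    obtain a where a: "a \<in> coatoms_below L t" "x \<subseteq> a"
      using coatom_above[OF L(1) x] .
    have "a \<notin> {x \<in> coatoms_below L t. \<forall>y\<in>set I. \<not> x \<subseteq> y}"
      unfolding stop.prems(3)[symmetric] by simp
    then obtain y where y: "y \<in> set I" "a \<subseteq> y" using a(1) by blast
    from y(1) subset_trans[OF a(2) y(2)] show ?thesis ..
  qed
  then show ?case by auto
next
  case (step N a C I J out1 C' out2)
  have "a \<in> {x \<in> coatoms_below L t. \<forall>y\<in>set I. \<not> x \<subseteq> y}"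
    unfolding step.prems(3)[symmetric] by simp
  then have a: "a \<in> coatoms_below L t" "\<forall>y\<in>set I. \<not> a \<subseteq> y" "a \<in> L" "a \<subset> t"
    by (auto simp: coatoms_below_def)
  have N: "set N = {x \<in> coatoms_below L a. \<forall>y\<in>set I. \<not> x \<subseteq> y}"
    unfolding step.hyps(1) by (rule next_coatoms_eq[OF L step.prems(2,3)]) simp_all
  have C': "set C' = {x \<in> coatoms_below L t. \<forall>y\<in>set (I @ [a \<union> J]). \<not> x \<subseteq> y}"
    unfolding step.hyps(4) set_filter step.prems(3) by auto
  have 1: "distinct out1" "set out1 = {x \<in> L. x \<subset> a \<and> (\<forall>y\<in>set I. \<not> x \<subseteq> y)}"
    using step.IH(1)[OF step.prems(1) a(3) N] by auto
  have 2: "distinct out2" "set out2 = {x \<in> L. x \<subset> t \<and> (\<forall>y\<in>set I. \<not> x \<subseteq> y) \<and> \<not> x \<subseteq> a}"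
    using step.IH(2)[OF step.prems(1,2) C'] step.prems(1) by auto
  show ?case
    using a 1 2 step.prems(1) by auto
qed

text \<open>Runs exist, so statements about all runs are not vacuous. The recursion descends in the
  length of \<open>C\<close>, and any enumeration of the next coatoms serves as
  \<open>N\<close>.\<close>

lemma ex_face_iterator: "\<exists>out. face_iterator C I J out"
proof (induction "length C" arbitrary: C I rule: less_induct)
  case less
  show ?case
  proof (cases C)
    case Nil
    then show ?thesis using face_iterator.stop by blast
  next
    case (Cons a D)
    have "finite (next_coatoms a C I)"
      by (rule finite_subset[of _ "(\<inter>) a ` set C"]) (auto simp: next_coatoms_def Let_def)
    then obtain N where N: "set N = next_coatoms a (a # D) I" "distinct N"
      using finite_distinct_list unfolding Cons by blast
    obtain out1 where 1: "face_iterator N I J out1"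
      using less[OF face_iterator_calls_shorter(1)[OF N, folded Cons]] by blast
    obtain out2 where
      2: "face_iterator (filter (\<lambda>x. \<not> x \<subseteq> a \<union> J) (a # D)) (I @ [a \<union> J]) J out2"
      using less[OF face_iterator_calls_shorter(2)[of a J D, folded Cons]] Cons by blast
    show ?thesis using face_iterator.step[OF N 1 refl 2] Cons by blast
  qed
qed

lemma ex_visit_cells: "\<exists>out. visit_cells V ds out"
proof (induction ds arbitrary: V)
  case Nil
  show ?case using visit_cells.nil by blast
next
  case (Cons d ds)
  show ?case
    using visit_cells.cons[OF refl refl] ex_face_iterator Cons.IH[of "V @ [cell_vertices d]"] by blast
qed

section \<open>Faces and vertices of polyhedral cones\<close>

lemma facet_of_imp_psubset: "F facet_of S \<Longrightarrow> F \<subset> S"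
  using facet_of_imp_subset facet_of_irrefl by blast

lemma facet_of_face:
  assumes "F face_of K" "G facet_of F"
  shows "G face_of K" "G \<noteq> {}" "G \<subset> F"
  using assms(2) facet_of_imp_psubset[OF assms(2)] face_of_trans[OF _ assms(1), of G]
  by (simp_all add: facet_of_def)

text \<open>Passing to a proper face lowers the dimension, and a facet is only one dimension below
  \<open>S\<close>, so no face fits strictly between.\<close>

lemma facet_of_incomparable:
  fixes S :: "'a::euclidean_space set"
  assumes "convex S" "F facet_of S" "G face_of S" "F \<subset> G"
  shows "G = S"
proof (rule ccontr)
  assume "G \<noteq> S"
  then have "aff_dim G < aff_dim S" using assms face_of_aff_dim_lt by blast
  moreover have "F face_of G"
    using assms face_of_face facet_of_imp_face_of by blast
  then have "aff_dim F < aff_dim G"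
    using assms face_of_aff_dim_lt face_of_imp_convex by blast
  ultimately show False using assms by (simp add: facet_of_def)
qed

text \<open>\<open>X\<close> is the intersection of the facets containing it, so one of them misses
  a point of \<open>Y\<close>.\<close>

lemma ex_facet_not_containing:
  fixes K :: "'a::euclidean_space set"
  assumes "polyhedron K" "X face_of K" "X \<noteq> {}" "X \<noteq> K" "\<not> Y \<subseteq> X"
  obtains Z where "Z facet_of K" "X \<subseteq> Z" "\<not> Y \<subseteq> Z"
  using face_of_polyhedron[OF assms(1-4)] assms(5) by blast

section \<open>The lineality space as the least nonempty face\<close>

lemma face_of_imp_convex_cone:
  assumes "convex_cone K" "F face_of K" "F \<noteq> {}"
  shows "convex_cone F"
  using assms face_of_conic face_of_imp_convex unfolding convex_cone_def by blast

text \<open>If \<open>x = (1 - u) a + u b\<close> and \<open>-x\<close> is in \<open>K\<close>, then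
  \<open>-a\<close> is the positive multiple \<open>1 / (1 - u)\<close> of \<open>-x + u b\<close>,
  an element of \<open>K\<close>.\<close>

lemma lineality_space_face_of:
  assumes "convex_cone (K :: 'a::euclidean_space set)"
  shows "lineality_space K face_of K"
proof -
  have K: "0 \<in> K" "\<And>x y. x \<in> K \<Longrightarrow> y \<in> K \<Longrightarrow> x + y \<in> K"
    "\<And>x c. x \<in> K \<Longrightarrow> c \<ge> 0 \<Longrightarrow> c *\<^sub>R x \<in> K"
    using assms by (auto simp: convex_cone_iff)
  have mem: "x \<in> lineality_space K \<longleftrightarrow> x \<in> K \<and> - x \<in> K" for x
    unfolding lineality_space_def by (auto simp: image_iff) (metis minus_minus)
  have cv: "convex (lineality_space K)"
    unfolding lineality_space_def using assms
    by (intro convex_Int convex_negations) (auto simp: convex_cone_def)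
  have end_mem: "a \<in> lineality_space K"
    if ab: "a \<in> K" "b \<in> K" "(1 - u) *\<^sub>R a + u *\<^sub>R b \<in> lineality_space K" "u < 1" "0 < u" for a b u
  proof -
    have "- ((1 - u) *\<^sub>R a + u *\<^sub>R b) + u *\<^sub>R b \<in> K"
      using ab K(2)[of "- ((1 - u) *\<^sub>R a + u *\<^sub>R b)" "u *\<^sub>R b"] K(3)[of b u] by (simp add: mem)
    then have "(1 / (1 - u)) *\<^sub>R (- ((1 - u) *\<^sub>R a + u *\<^sub>R b) + u *\<^sub>R b) \<in> K"
      by (rule K(3)) (use ab in simp)
    also have "(1 / (1 - u)) *\<^sub>R (- ((1 - u) *\<^sub>R a + u *\<^sub>R b) + u *\<^sub>R b) = - a"
      using ab by simp
    finally show ?thesis using ab by (simp add: mem)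
  qed
  have ends: "a \<in> lineality_space K" "b \<in> lineality_space K"
    if ab: "a \<in> K" "b \<in> K" "x \<in> lineality_space K" "x \<in> open_segment a b" for a b x
  proof -
    obtain u where u: "0 < u" "u < 1" "x = (1 - u) *\<^sub>R a + u *\<^sub>R b"
      using ab by (auto simp: in_segment)
    \<comment> \<open>Exchanging the end points lets \<open>end_mem\<close> treat \<open>b\<close>
      as well.\<close>
    have x': "x = (1 - (1 - u)) *\<^sub>R b + (1 - u) *\<^sub>R a" using u by (simp add: add.commute)
    show "a \<in> lineality_space K" "b \<in> lineality_space K"
      using end_mem[OF ab(1,2) ab(3)[unfolded u(3)]] end_mem[OF ab(2,1) ab(3)[unfolded x']] u
      by simp_all
  qed
  have "lineality_space K \<subseteq> K" by (simp add: lineality_space_def)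
  then show ?thesis
    unfolding face_of_def using cv ends by (intro conjI ballI impI)
qed

lemma zero_mem_lineality_space: "convex_cone K \<Longrightarrow> 0 \<in> lineality_space K"
  by (auto simp: lineality_space_def convex_cone_iff image_iff intro!: bexI[of _ 0])

text \<open>A nonempty face contains \<open>0\<close>, the midpoint of \<open>x\<close> and
  \<open>-x\<close>, hence both end points.\<close>

lemma lineality_space_subset_face:
  assumes "convex_cone (K :: 'a::euclidean_space set)" "F face_of K" "F \<noteq> {}"
  shows "lineality_space K \<subseteq> F"
proof
  fix x assume x: "x \<in> lineality_space K"
  have 0: "0 \<in> F" using face_of_imp_convex_cone[OF assms] by (simp add: convex_cone_iff)
  have xK: "x \<in> K" "- x \<in> K" using x by (auto simp: lineality_space_def)
  show "x \<in> F"
  proof (cases "x = 0")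
    case False
    then have "x \<noteq> - x"
      by (metis add.inverse_inverse add.right_inverse scaleR_2 scaleR_eq_0_iff zero_neq_numeral)
    then have "0 \<in> open_segment x (- x)"
      unfolding in_segment by (auto intro!: exI[of _ "1/2"])
    then show ?thesis using 0 xK assms(2) unfolding face_of_def by blast
  qed (simp add: 0)
qed

text \<open>All nonempty faces share one lineality space, so the dimension condition defining
  vertices is the same for a face as for the whole cone.\<close>

lemma lineality_space_face:
  assumes "convex_cone (K :: 'a::euclidean_space set)" "F face_of K" "F \<noteq> {}"
  shows "lineality_space F = lineality_space K"
proof
  show "lineality_space F \<subseteq> lineality_space K"
    using face_of_imp_subset[OF assms(2)] by (auto simp: lineality_space_def)
  have "- x \<in> lineality_space K" if "x \<in> lineality_space K" for x
    using that by (auto simp: lineality_space_def)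
  then show "lineality_space K \<subseteq> lineality_space F"
    using lineality_space_subset_face[OF assms] unfolding lineality_space_def by force
qed

section \<open>Faces are determined by their vertices\<close>

lemma cone_vertices_face:
  assumes "convex_cone (K :: 'a::euclidean_space set)" "F face_of K" "F \<noteq> {}"
  shows "cone_vertices F = {R \<in> cone_vertices K. R \<subseteq> F}"
  using lineality_space_face[OF assms] face_of_face[OF assms(2)]
  by (auto simp: cone_vertices_def)

lemma cone_vertices_Int:
  assumes "convex_cone (K :: 'a::euclidean_space set)"
    and "F face_of K" "F \<noteq> {}" "G face_of K" "G \<noteq> {}"
  shows "cone_vertices (F \<inter> G) = cone_vertices F \<inter> cone_vertices G" "F \<inter> G \<noteq> {}"
proof -
  show "F \<inter> G \<noteq> {}"
    using lineality_space_subset_face[OF assms(1)] zero_mem_lineality_space[OF assms(1)] assms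
    by blast
  then show "cone_vertices (F \<inter> G) = cone_vertices F \<inter> cone_vertices G"
    using cone_vertices_face[OF assms(1) face_of_Int[OF assms(2,4)]]
      cone_vertices_face[OF assms(1-3)] cone_vertices_face[OF assms(1,4,5)] by auto
qed

text \<open>The lineality space stands for the empty face of the polytope: no subset of it has
  larger dimension.\<close>

lemma cone_vertices_lineality_space:
  assumes "convex_cone (K :: 'a::euclidean_space set)"
  shows "cone_vertices (lineality_space K) = {}"
proof -
  have "\<not> aff_dim R = aff_dim (lineality_space K) + 1" if "R \<subseteq> lineality_space K" for R
    using aff_dim_subset[OF that] by simp
  then show ?thesis
    using cone_vertices_face[OF assms lineality_space_face_of[OF assms]] zero_mem_lineality_space[OF assms]
    by (auto simp: cone_vertices_def)
qed

text \<open>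
  Let \<open>Y\<close> be a facet containing \<open>X\<close>. If \<open>Y\<close> is the lineality space, then \<open>K\<close> itself is a vertex.
  Otherwise there is another facet \<open>Z\<close>, and induction gives a vertex of \<open>Z\<close> outside of \<open>Z \<inter> Y\<close>.
\<close>

lemma ex_cone_vertex_not_in_face:
  fixes K :: "'a::euclidean_space set"
  assumes "polyhedron K" "convex_cone K" "X face_of K" "X \<noteq> {}" "X \<noteq> K"
  shows "\<exists>R\<in>cone_vertices K. \<not> R \<subseteq> X"
  using assms
proof (induction "nat (aff_dim K + 1)" arbitrary: K X rule: less_induct)
  case less
  have "convex K" using less.prems(1) by (rule polyhedron_imp_convex)
  obtain Y where Y: "Y facet_of K" "X \<subseteq> Y"
    using face_of_polyhedron_subset_facet[OF less.prems(1,3,4,5)] .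
  have Yf: "Y face_of K" "Y \<noteq> {}" using Y by (auto simp: facet_of_def)
  have KX: "\<not> K \<subseteq> X" using face_of_imp_subset[OF less.prems(3)] less.prems(5) by simp
  show ?case
  proof (cases "Y = lineality_space K")
    case True
    then have "K \<in> cone_vertices K"
      using Y \<open>convex K\<close> by (auto simp: cone_vertices_def facet_of_def face_of_refl)
    then show ?thesis using KX by blast
  next
    case False
    have L: "lineality_space K face_of K" "0 \<in> lineality_space K"
      using lineality_space_face_of[OF less.prems(2)] zero_mem_lineality_space[OF less.prems(2)] by simp_all
    have "\<not> Y \<subseteq> lineality_space K"
      using lineality_space_subset_face[OF less.prems(2) Yf] False by blast
    moreover have "lineality_space K \<noteq> {}" using L(2) by blast
    moreover have "lineality_space K \<noteq> K"
      using calculation(1) face_of_imp_subset[OF Yf(1)] by simp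
    \<comment> \<open>The facets containing the lineality space intersect in it, and
      \<open>Y\<close> is not contained in it, so some facet \<open>Z\<close> does not contain
      \<open>Y\<close>. Facets being incomparable, \<open>Z\<close> is not inside \<open>Y\<close>
      either.\<close>
    ultimately obtain Z where Z: "Z facet_of K" "\<not> Y \<subseteq> Z"
      using ex_facet_not_containing[OF less.prems(1) L(1)] by metis
    have Zf: "Z face_of K" "Z \<noteq> {}" using Z by (auto simp: facet_of_def)
    have ZY: "\<not> Z \<subseteq> Y"
      using facet_of_incomparable[OF \<open>convex K\<close> Z(1) Yf(1)] Z(2) facet_of_imp_psubset[OF Y(1)] by auto
    have int: "Z \<inter> Y face_of Z" "Z \<inter> Y \<noteq> {}"
      using face_of_Int[OF Zf(1) Yf(1)] face_of_face[OF Zf(1)]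
        cone_vertices_Int(2)[OF less.prems(2) Zf Yf] by simp_all
    have ne: "Z \<inter> Y \<noteq> Z" using ZY by auto
    have "aff_dim Z < aff_dim K" "aff_dim Z \<ge> 0"
      using Z(1) aff_dim_negative_iff[of Z] Zf(2) by (simp_all add: facet_of_def)
    then have "nat (aff_dim Z + 1) < nat (aff_dim K + 1)" by simp
    from less.hyps[OF this face_of_polyhedron_polyhedron[OF less.prems(1) Zf(1)]
          face_of_imp_convex_cone[OF less.prems(2) Zf] int ne]
    obtain R where "R \<in> cone_vertices Z" "\<not> R \<subseteq> Z \<inter> Y" by (elim bexE)
    then have "R \<in> cone_vertices K" "\<not> R \<subseteq> X"
      using Y(2) unfolding cone_vertices_face[OF less.prems(2) Zf] by auto
    then show ?thesis by (intro bexI)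
  qed
qed

text \<open>The face \<open>F \<inter> G\<close> of \<open>F\<close> contains every vertex of
  \<open>F\<close>, and a proper face would miss one.\<close>

lemma cone_vertices_subset_iff:
  fixes K :: "'a::euclidean_space set"
  assumes "polyhedron K" "convex_cone K" "F face_of K" "F \<noteq> {}" "G face_of K" "G \<noteq> {}"
  shows "cone_vertices F \<subseteq> cone_vertices G \<longleftrightarrow> F \<subseteq> G"
proof
  assume "F \<subseteq> G"
  then show "cone_vertices F \<subseteq> cone_vertices G"
    using cone_vertices_face[OF assms(2-4)] cone_vertices_face[OF assms(2,5,6)] by auto
next
  assume vert: "cone_vertices F \<subseteq> cone_vertices G"
  have F: "polyhedron F" "convex_cone F"
    using face_of_polyhedron_polyhedron[OF assms(1,3)] face_of_imp_convex_cone[OF assms(2-4)]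
    by simp_all
  have "F \<inter> G face_of F" 
    using face_of_Int[OF assms(3,5)] face_of_face[OF assms(3)] by simp
  moreover have "R \<subseteq> F \<inter> G" if "R \<in> cone_vertices F" for R
    using that vert by (auto simp: cone_vertices_def dest: face_of_imp_subset)
  ultimately show "F \<subseteq> G"
    using ex_cone_vertex_not_in_face[OF F] cone_vertices_Int(2)[OF assms(2-6)] by blast
qed

section \<open>The lattice of labelled vertex sets\<close>

text \<open>\<open>G \<noteq> {}\<close> discards the empty face of the cone. For a convex cone the
  empty face of the polytope enters through the lineality space, as the empty set of labels.\<close>

definition labelled_faces :: "('b::euclidean_space set \<Rightarrow> nat) \<Rightarrow> 'b set \<Rightarrow> nat set set" where
  "labelled_faces lab K = {lab ` cone_vertices G | G. G face_of K \<and> G \<noteq> {}}"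

lemma mem_labelled_faces:
  assumes "F face_of K" "F \<noteq> {}"
  shows "lab ` cone_vertices F \<in> labelled_faces lab K"
  using assms unfolding labelled_faces_def by blast

lemma finite_labelled_faces: "polyhedron K \<Longrightarrow> finite (labelled_faces lab K)"
  unfolding labelled_faces_def
  by (rule finite_surj[OF finite_polyhedron_faces[of K], of _ "\<lambda>G. lab ` cone_vertices G"]) auto

context
  fixes K :: "'b::euclidean_space set" and lab :: "'b set \<Rightarrow> nat"
  assumes K: "polyhedron K" "convex_cone K" and inj: "inj_on lab (cone_vertices K)"
begin

lemma labelled_subset_iff:
  assumes "F face_of K" "F \<noteq> {}" "G face_of K" "G \<noteq> {}"
  shows "lab ` cone_vertices F \<subseteq> lab ` cone_vertices G \<longleftrightarrow> F \<subseteq> G"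
  using cone_vertices_subset_iff[OF K assms]
    cone_vertices_face[OF K(2) assms(1,2)] cone_vertices_face[OF K(2) assms(3,4)]
  by (subst inj_on_image_subset_iff[OF inj]) auto

lemma labelled_psubset_iff:
  assumes "F face_of K" "F \<noteq> {}" "G face_of K" "G \<noteq> {}"
  shows "lab ` cone_vertices F \<subset> lab ` cone_vertices G \<longleftrightarrow> F \<subset> G"
  unfolding less_le_not_le labelled_subset_iff[OF assms]
    labelled_subset_iff[OF assms(3,4,1,2)] ..

lemma labelled_faces_Int:
  assumes "x \<in> labelled_faces lab K" "y \<in> labelled_faces lab K"
  shows "x \<inter> y \<in> labelled_faces lab K"
proof -
  obtain F G where FG: "F face_of K" "F \<noteq> {}" "G face_of K" "G \<noteq> {}"
    and xy: "x = lab ` cone_vertices F" "y = lab ` cone_vertices G"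
    using assms by (auto simp: labelled_faces_def)
  have "cone_vertices F \<subseteq> cone_vertices K" "cone_vertices G \<subseteq> cone_vertices K"
    using cone_vertices_face[OF K(2) FG(1,2)] cone_vertices_face[OF K(2) FG(3,4)] by simp_all
  then have "x \<inter> y = lab ` cone_vertices (F \<inter> G)"
    unfolding xy cone_vertices_Int(1)[OF K(2) FG] by (rule inj_on_image_Int[OF inj, symmetric])
  then show ?thesis
    using mem_labelled_faces[OF face_of_Int[OF FG(1,3)] cone_vertices_Int(2)[OF K(2) FG]] by simp
qed

text \<open>Labelling is an order embedding, so covering is decided among the faces: a proper
  nonempty face lies in a facet, and no face fits strictly between a facet and \<open>F\<close>.
  Hence facet lists are coatom lists.\<close>

lemma coatoms_below_labelled_faces:
  assumes F: "F face_of K" "F \<noteq> {}"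
  shows "coatoms_below (labelled_faces lab K) (lab ` cone_vertices F) =
    {lab ` cone_vertices G | G. G facet_of F}" (is "?C = ?R")
proof (intro equalityI subsetI)
  have Fp: "polyhedron F" "convex F"
    using face_of_polyhedron_polyhedron[OF K(1) F(1)] face_of_imp_convex[OF F(1)] by simp_all
  fix x assume "x \<in> ?C"
  then obtain G where G: "G face_of K" "G \<noteq> {}" and x: "x = lab ` cone_vertices G"
    and lt: "x \<subset> lab ` cone_vertices F"
    and max: "\<forall>y\<in>labelled_faces lab K. x \<subset> y \<longrightarrow> \<not> y \<subset> lab ` cone_vertices F"
    by (auto simp: coatoms_below_def labelled_faces_def)
  have GF: "G \<subset> F" using lt labelled_psubset_iff[OF G F] x by simp
  then have "G face_of F" "G \<noteq> F" using face_of_face[OF F(1)] G(1) by auto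
  from face_of_polyhedron_subset_facet[OF Fp(1) this(1) G(2) this(2)]
  obtain H where H: "H facet_of F" "G \<subseteq> H" .
  note HK = facet_of_face[OF F(1) H(1)]
  have "\<not> G \<subset> H"
    using bspec[OF max mem_labelled_faces[OF HK(1,2)]] HK(3)
    unfolding x labelled_psubset_iff[OF HK(1,2) F] labelled_psubset_iff[OF G HK(1,2)] by simp
  then have "G = H" using H(2) by auto
  then show "x \<in> ?R" using H(1) x by blast
next
  have Fp: "convex F" using face_of_imp_convex[OF F(1)] .
  fix x assume "x \<in> ?R"
  then obtain G where G: "G facet_of F" and x: "x = lab ` cone_vertices G" by auto
  note GK = facet_of_face[OF F(1) G]
  have "\<not> lab ` cone_vertices H \<subset> lab ` cone_vertices F"
    if H: "H face_of K" "H \<noteq> {}" and lt: "x \<subset> lab ` cone_vertices H" for H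
  proof
    assume "lab ` cone_vertices H \<subset> lab ` cone_vertices F"
    then have "H \<subset> F" unfolding labelled_psubset_iff[OF H F] .
    moreover from this have "H face_of F" using face_of_face[OF F(1)] H(1) by auto
    moreover have "G \<subset> H" using lt unfolding x labelled_psubset_iff[OF GK(1,2) H] .
    ultimately show False using facet_of_incomparable[OF Fp G] by blast
  qed
  moreover have "x \<subset> lab ` cone_vertices F"
    unfolding x labelled_psubset_iff[OF GK(1,2) F] by (rule GK(3))
  ultimately show "x \<in> ?C"
    using mem_labelled_faces[OF GK(1,2)] x by (auto simp: coatoms_below_def labelled_faces_def)
qed

text \<open>A face \<open>X\<close> of \<open>Z\<close> strictly inside a facet \<open>Y\<close> of \<open>Z\<close> lies in a second facet, being the
  intersection of the facets containing it.\<close>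

lemma locally_branched_labelled_faces: "locally_branched (labelled_faces lab K)"
  unfolding locally_branched_def
proof (intro ballI)
  let ?L = "labelled_faces lab K"
  fix x y z assume "z \<in> ?L" and y: "y \<in> coatoms_below ?L z" and x: "x \<in> coatoms_below ?L y"
  then obtain Z where Z: "Z face_of K" "Z \<noteq> {}" and z: "z = lab ` cone_vertices Z"
    by (auto simp: labelled_faces_def)
  obtain Y where Y: "Y facet_of Z" and y: "y = lab ` cone_vertices Y"
    using y unfolding z coatoms_below_labelled_faces[OF Z] by auto
  note YK = facet_of_face[OF Z(1) Y]
  obtain X where X: "X facet_of Y" and x: "x = lab ` cone_vertices X"
    using x unfolding y coatoms_below_labelled_faces[OF YK(1,2)] by auto
  note XK = facet_of_face[OF YK(1) X]
  have "X face_of Z" "X \<noteq> Z" "\<not> Y \<subseteq> X"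
    using face_of_face[OF Z(1)] XK YK by auto
  from ex_facet_not_containing[OF face_of_polyhedron_polyhedron[OF K(1) Z(1)] this(1) XK(2) this(2,3)]
  obtain W where W: "W facet_of Z" "X \<subseteq> W" "\<not> Y \<subseteq> W" .
  note WK = facet_of_face[OF Z(1) W(1)]
  \<comment> \<open>\<open>X\<close> has codimension two in \<open>Z\<close> and \<open>W\<close>
    codimension one, so the inclusion is strict.\<close>
  have "aff_dim X < aff_dim W"
    using X Y W(1) by (simp add: facet_of_def)
  then have "X \<subset> W" using W(2) by auto
  then have "x \<subset> lab ` cone_vertices W" "lab ` cone_vertices W \<subset> z" "lab ` cone_vertices W \<noteq> y"
    using WK(3) W(3) labelled_subset_iff[OF YK(1,2) WK(1,2)]
    unfolding x z y labelled_psubset_iff[OF XK(1,2) WK(1,2)] labelled_psubset_iff[OF WK(1,2) Z]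
    by auto
  then show "\<exists>w\<in>?L. w \<noteq> y \<and> x \<subset> w \<and> w \<subset> z"
    by (intro bexI[OF _ mem_labelled_faces[OF WK(1,2)]] conjI)
qed

end

section \<open>Homogenization\<close>

lemma convex_cone_dehomogenize:
  assumes "convex_cone (G :: ('a::real_vector \<times> real) set)" "y \<in> G" "0 < snd y"
  shows "((1 / snd y) *\<^sub>R fst y, 1) \<in> G"
proof -
  have "(1 / snd y) *\<^sub>R y \<in> G" using assms by (simp add: convex_cone_iff)
  moreover have "(1 / snd y) *\<^sub>R y = ((1 / snd y) *\<^sub>R fst y, 1)"
    using assms(3) by (simp add: prod_eq_iff)
  ultimately show ?thesis by simp
qed

text \<open>A point at infinity of \<open>G\<close> is the limit of the finite points on the segment to \<open>(p, 1)\<close>.\<close>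

lemma homog_cone_slice:
  fixes G :: "('a::euclidean_space \<times> real) set"
  assumes "closed G" and G: "convex_cone G" and snd: "\<And>y. y \<in> G \<Longrightarrow> 0 \<le> snd y"
    and p: "(p, 1) \<in> G"
  shows "homog_cone {x. (x, 1) \<in> G} = G"
proof
  let ?S = "{x. (x, 1) \<in> G} \<times> {1::real}"
  let ?H = "cone hull ?S"
  have G': "\<And>x y. x \<in> G \<Longrightarrow> y \<in> G \<Longrightarrow> x + y \<in> G" "\<And>x c. x \<in> G \<Longrightarrow> 0 \<le> c \<Longrightarrow> c *\<^sub>R x \<in> G"
    using G by (simp_all add: convex_cone_iff)
  have "?H \<subseteq> G"
    by (rule hull_minimal) (auto simp: cone_def G'(2))
  then show "homog_cone {x. (x, 1) \<in> G} \<subseteq> G"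
    unfolding homog_cone_def by (rule closure_minimal[OF _ \<open>closed G\<close>])
  have pos: "y \<in> ?H" if y: "y \<in> G" "0 < snd y" for y
  proof -
    have "((1 / snd y) *\<^sub>R fst y, 1) \<in> ?S"
      using convex_cone_dehomogenize[OF G y] by simp
    from mem_cone_hull[OF this, of "snd y"] show ?thesis
      using y(2) by (cases y) simp
  qed
  show "G \<subseteq> homog_cone {x. (x, 1) \<in> G}"
  proof
    fix y assume y: "y \<in> G"
    let ?s = "\<lambda>n. y + inverse (real (Suc n)) *\<^sub>R (p, 1)"
    have "?s n \<in> ?H" for n
      using pos[OF G'(1)[OF y G'(2)[OF p]]] snd[OF y] by (simp add: add_nonneg_pos)
    moreover have "?s \<longlonglongrightarrow> y + 0 *\<^sub>R (p, 1)"
      by (intro tendsto_intros LIMSEQ_inverse_real_of_nat)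
    ultimately show "y \<in> homog_cone {x. (x, 1) \<in> G}"
      unfolding homog_cone_def closure_sequential by (intro exI[of _ ?s]) (simp flip: zero_prod_def)
  qed
qed

lemma vertices_of_imp_subset: "R \<in> vertices_of P \<Longrightarrow> R \<subseteq> homog_cone P"
  by (simp add: vertices_of_def cone_vertices_def face_of_imp_subset)

lemma vertices_of_empty: "vertices_of {} = {}"
proof -
  have "homog_cone ({} :: 'a set) = {}"
    by (simp add: homog_cone_def cone_hull_empty)
  then show ?thesis
    by (auto simp: vertices_of_def cone_vertices_def lineality_space_def)
qed

text \<open>Replacing each inequality \<open>a x \<le> b\<close> by \<open>a x - b t \<le> 0\<close>
  and adding \<open>t \<ge> 0\<close> gives a polyhedral cone with slice \<open>P\<close> at height
  1. As that slice is nonempty, the cone is the homogenization, and all four facts can be read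
  off.\<close>

lemma
  fixes P :: "'a::euclidean_space set"
  assumes P: "polyhedron P" "P \<noteq> {}"
  shows polyhedron_homog_cone: "polyhedron (homog_cone P)"
    and convex_cone_homog_cone: "convex_cone (homog_cone P)"
    and mem_homog_cone_iff: "(x, 1) \<in> homog_cone P \<longleftrightarrow> x \<in> P"
    and snd_homog_cone_nonneg: "y \<in> homog_cone P \<Longrightarrow> 0 \<le> snd y"
proof -
  obtain F where F: "finite F" "P = \<Inter> F" "\<forall>h\<in>F. \<exists>a b. h = {x. a \<bullet> x \<le> b}"
    using P unfolding polyhedron_def by metis
  then obtain a b where ab: "\<And>h. h \<in> F \<Longrightarrow> h = {x. a h \<bullet> x \<le> b h}" by metis
  define \<H> where "\<H> = insert {y. (0, 1) \<bullet> y \<ge> 0} ((\<lambda>h. {y. (a h, - b h) \<bullet> y \<le> 0}) ` F)"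
  define G where "G = \<Inter> \<H>"
  have poly: "polyhedron G"
    unfolding G_def by (rule polyhedron_Inter)
      (auto simp: \<H>_def F(1) polyhedron_halfspace_ge polyhedron_halfspace_le)
  have cc: "convex_cone G"
    unfolding G_def by (rule convex_cone_Inter)
      (auto simp: \<H>_def convex_cone_halfspace_ge convex_cone_halfspace_le)
  have nonneg: "0 \<le> snd y" if "y \<in> G" for y
    using that by (cases y) (simp add: G_def \<H>_def)
  have mem: "(x, 1) \<in> G \<longleftrightarrow> x \<in> P" for x
  proof -
    have "(x, 1) \<in> G \<longleftrightarrow> (\<forall>h\<in>F. a h \<bullet> x \<le> b h)" by (auto simp: G_def \<H>_def)
    also have "\<dots> \<longleftrightarrow> (\<forall>h\<in>F. x \<in> h)" by (intro ball_cong refl) (use ab in blast)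
    finally show ?thesis unfolding F(2) by simp
  qed
  obtain p where "p \<in> P" using P(2) by auto
  then have "homog_cone {x. (x, 1) \<in> G} = G"
    using homog_cone_slice[OF polyhedron_imp_closed[OF poly] cc nonneg] mem by blast
  then have eq: "homog_cone P = G" by (simp add: mem)
  show "polyhedron (homog_cone P)" "convex_cone (homog_cone P)"
    "(x, 1) \<in> homog_cone P \<longleftrightarrow> x \<in> P" "y \<in> homog_cone P \<Longrightarrow> 0 \<le> snd y"
    unfolding eq by (rule poly, rule cc, rule mem, rule nonneg)
qed

section \<open>Intersections and faces under homogenization\<close>

text \<open>The intersection of the cones is a closed convex cone with slice
  \<open>P \<inter> Q\<close> at height 1, which determines it once it is nonempty. Disjoint
  polyhedra may still share directions at infinity, hence the demand for a common point.\<close>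

lemma homog_cone_Int:
  fixes P Q :: "'a::euclidean_space set"
  assumes "polyhedron P" "polyhedron Q" "P \<inter> Q \<noteq> {}"
  shows "homog_cone (P \<inter> Q) = homog_cone P \<inter> homog_cone Q"
proof -
  have ne: "P \<noteq> {}" "Q \<noteq> {}" using assms by auto
  note P = assms(1) ne(1) and Q = assms(2) ne(2)
  obtain p where "p \<in> P" "p \<in> Q" using assms(3) by auto
  then have "(p, 1) \<in> homog_cone P \<inter> homog_cone Q"
    using mem_homog_cone_iff[OF P] mem_homog_cone_iff[OF Q] by simp
  moreover have "closed (homog_cone P \<inter> homog_cone Q)"
    using polyhedron_imp_closed polyhedron_homog_cone[OF P] polyhedron_homog_cone[OF Q] by blast
  moreover have "convex_cone (homog_cone P \<inter> homog_cone Q)"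
    using convex_cone_homog_cone[OF P] convex_cone_homog_cone[OF Q] by (simp add: convex_cone_iff)
  ultimately have "homog_cone {x. (x, 1) \<in> homog_cone P \<inter> homog_cone Q} = homog_cone P \<inter> homog_cone Q"
    using snd_homog_cone_nonneg[OF P] by (intro homog_cone_slice) auto
  moreover have "{x. (x, 1) \<in> homog_cone P \<inter> homog_cone Q} = P \<inter> Q"
    using mem_homog_cone_iff[OF P] mem_homog_cone_iff[OF Q] by auto
  ultimately show ?thesis by simp
qed

text \<open>Faces of polyhedra are exposed: a supporting hyperplane \<open>a x = b\<close> of
  \<open>P\<close> homogenizes to one of the cone, and the face it cuts off has slice
  \<open>F\<close>.\<close>

lemma homog_cone_face_of:
  fixes P :: "'a::euclidean_space set"
  assumes P: "polyhedron P" and F: "F face_of P" "F \<noteq> {}"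
  shows "homog_cone F face_of homog_cone P"
proof -
  have ne: "P \<noteq> {}" using F face_of_imp_subset by auto
  note K = polyhedron_homog_cone[OF P ne] convex_cone_homog_cone[OF P ne]
  obtain a b where ab: "P \<subseteq> {x. a \<bullet> x \<le> b}" "F = P \<inter> {x. a \<bullet> x = b}"
    using exposed_face_of_polyhedron[OF P] F(1) unfolding exposed_face_of_def by metis
  let ?G = "homog_cone P \<inter> {y. (a, - b) \<bullet> y = 0}"
  have "cone hull (P \<times> {1}) \<subseteq> {y. (a, - b) \<bullet> y \<le> 0}"
    using ab(1) by (intro hull_minimal) (auto simp: cone_def mult_nonneg_nonpos)
  then have "homog_cone P \<subseteq> {y. (a, - b) \<bullet> y \<le> 0}"
    unfolding homog_cone_def by (rule closure_minimal) (rule closed_halfspace_le)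
  then have face: "?G face_of homog_cone P"
    by (intro face_of_Int_supporting_hyperplane_le polyhedron_imp_convex[OF K(1)]) auto
  obtain p where "p \<in> F" using F(2) by auto
  then have "(p, 1) \<in> ?G" using ab(2) mem_homog_cone_iff[OF P ne] by simp
  moreover have "closed ?G"
    using polyhedron_imp_closed[OF K(1)] closed_hyperplane by (rule closed_Int)
  moreover have "convex_cone ?G"
    using K(2) by (auto simp: convex_cone_iff inner_add_right)
  ultimately have "homog_cone {x. (x, 1) \<in> ?G} = ?G"
    using snd_homog_cone_nonneg[OF P ne] by (intro homog_cone_slice) auto
  moreover have "{x. (x, 1) \<in> ?G} = F"
    unfolding ab(2) using mem_homog_cone_iff[OF P ne] by auto
  ultimately show ?thesis using face by simp
qed

text \<open>\<open>F\<close> is the slice of \<open>G\<close> at height 1; the point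
  \<open>y\<close> makes it nonempty, so that it determines \<open>G\<close>.\<close>

lemma face_of_homog_coneE:
  fixes P :: "'a::euclidean_space set"
  assumes P: "polyhedron P" "P \<noteq> {}" and G: "G face_of homog_cone P" "y \<in> G" "0 < snd y"
  obtains F where "F face_of P" "F \<noteq> {}" "G = homog_cone F"
proof
  note K = polyhedron_homog_cone[OF P] convex_cone_homog_cone[OF P]
  let ?F = "{x. (x, 1) \<in> G}"
  have cc: "convex_cone G" using face_of_imp_convex_cone[OF K(2) G(1)] G(2) by auto
  note mem = convex_cone_dehomogenize[OF cc G(2,3)]
  then show "?F \<noteq> {}" by auto
  have "closed G"
    using face_of_imp_closed[OF polyhedron_imp_convex polyhedron_imp_closed G(1)] K(1) by simp
  then show "G = homog_cone ?F"
    using homog_cone_slice[OF _ cc _ mem] snd_homog_cone_nonneg[OF P] face_of_imp_subset[OF G(1)] by auto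
  have sub: "?F \<subseteq> P"
    using face_of_imp_subset[OF G(1)] mem_homog_cone_iff[OF P] by auto
  have cv: "convex ?F"
  proof (rule convexI)
    fix u v :: 'a and c d :: real
    assume "u \<in> ?F" "v \<in> ?F" and cd: "0 \<le> c" "0 \<le> d" "c + d = 1"
    then have "c *\<^sub>R (u, 1) + d *\<^sub>R (v, 1) \<in> G"
      using cc by (intro convexD) (auto simp: convex_cone_def)
    then show "c *\<^sub>R u + d *\<^sub>R v \<in> ?F" using cd by simp
  qed
  have ends: "u \<in> ?F" "v \<in> ?F"
    if uv: "u \<in> P" "v \<in> P" "w \<in> ?F" "w \<in> open_segment u v" for u v w
  proof -
    obtain c where c: "0 < c" "c < 1" "w = (1 - c) *\<^sub>R u + c *\<^sub>R v" "u \<noteq> v"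
      using uv(4) unfolding in_segment by blast
    \<comment> \<open>Segments in \<open>P\<close> lift to segments at height 1, where the face
      property of \<open>G\<close> applies.\<close>
    then have "(w, 1) \<in> open_segment (u, 1::real) (v, 1)"
      unfolding in_segment by (auto intro!: exI[of _ c])
    moreover have "(u, 1) \<in> homog_cone P" "(v, 1) \<in> homog_cone P"
      using uv mem_homog_cone_iff[OF P] by simp_all
    ultimately show "u \<in> ?F" "v \<in> ?F" using uv(3) G(1) unfolding face_of_def by blast+
  qed
  show "?F face_of P"
    unfolding face_of_def using sub cv ends by (intro conjI ballI impI)
qed

text \<open>Heights are nonnegative on the cone, so height 0 is a supporting hyperplane. The face it
  cuts off carries the labels of the marked face.\<close>

lemma infinite_part_face_of:
  fixes P :: "'a::euclidean_space set"
  assumes P: "polyhedron P" "P \<noteq> {}"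
  shows "homog_cone P \<inter> {z. snd z = 0} face_of homog_cone P" (is "?X face_of _")
    and "0 \<in> homog_cone P \<inter> {z. snd z = 0}"
    and "homog_cone P \<inter> {z. snd z = 0} \<noteq> homog_cone P"
proof -
  note K = polyhedron_homog_cone[OF P] convex_cone_homog_cone[OF P]
  have eq: "{z. snd z = 0} = {z::'a \<times> real. (0, 1) \<bullet> z = 0}" by (auto simp: inner_prod_def)
  show "?X face_of homog_cone P"
    unfolding eq using snd_homog_cone_nonneg[OF P]
    by (intro face_of_Int_supporting_hyperplane_ge polyhedron_imp_convex[OF K(1)])
      (auto simp: inner_prod_def)
  show "0 \<in> ?X" using K(2) by (simp add: convex_cone_iff)
  obtain p where "p \<in> P" using P(2) by auto
  then have "(p, 1) \<in> homog_cone P" "(p, 1) \<notin> ?X" using mem_homog_cone_iff[OF P] by simp_all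
  then show "?X \<noteq> homog_cone P" by blast
qed

text \<open>The part at infinity is a proper face, so some vertex is not contained in it.\<close>

lemma ex_finite_vertex:
  fixes P :: "'a::euclidean_space set"
  assumes P: "polyhedron P" "P \<noteq> {}"
  obtains R y where "R \<in> vertices_of P" "y \<in> R" "0 < snd y"
proof -
  note X = infinite_part_face_of[OF P]
  have "homog_cone P \<inter> {z. snd z = 0} \<noteq> {}" using X(2) by blast
  from ex_cone_vertex_not_in_face[OF polyhedron_homog_cone[OF P] convex_cone_homog_cone[OF P]
      X(1) this X(3)]
  obtain R where R: "R \<in> cone_vertices (homog_cone P)" "\<not> R \<subseteq> homog_cone P \<inter> {z. snd z = 0}"
    by (elim bexE)
  have sub: "R \<subseteq> homog_cone P"
    using R(1) by (intro vertices_of_imp_subset) (simp add: vertices_of_def)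
  then obtain y where y: "y \<in> R" "snd y \<noteq> 0" using R(2) by auto
  then have "0 < snd y" using snd_homog_cone_nonneg[OF P, of y] sub by auto
  with R(1) y(1) show thesis by (intro that) (simp_all add: vertices_of_def)
qed

lemma vertices_of_face:
  fixes P :: "'a::euclidean_space set"
  assumes P: "polyhedron P" and F: "F face_of P"
  shows "vertices_of F = {R \<in> vertices_of P. R \<subseteq> homog_cone F}"
proof (cases "F = {}")
  case True
  \<comment> \<open>\<open>homog_cone {}\<close> is empty, so only the empty set could be a vertex
    inside it; but vertices have dimension at least 0.\<close>
  have "R \<noteq> {}" if "R \<in> vertices_of P" for R
  proof
    assume "R = {}"
    then have "lineality_space (homog_cone P) = {}"
      using that aff_dim_geq[of "lineality_space (homog_cone P)"]
      by (auto simp: vertices_of_def cone_vertices_def)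
    then have "P = {}"
      using zero_mem_lineality_space[OF convex_cone_homog_cone[OF P]] by auto
    then show False using that by (simp add: vertices_of_empty)
  qed
  then show ?thesis
    using True vertices_of_empty by (auto simp: homog_cone_def cone_hull_empty)
next
  case False
  have ne: "P \<noteq> {}" using False F face_of_imp_subset by auto
  have "homog_cone F \<noteq> {}"
    using False mem_homog_cone_iff[OF face_of_polyhedron_polyhedron[OF P F] False] by auto
  then show ?thesis
    unfolding vertices_of_def
    by (rule cone_vertices_face[OF convex_cone_homog_cone[OF P ne] homog_cone_face_of[OF P F False]])
qed

text \<open>
  A finite vertex of \<open>F\<close> that is also one of \<open>Q\<close> shows that \<open>F\<close> and \<open>Q\<close> meet, and only then does
  the cone of \<open>F \<inter> Q\<close> contain the common vertices at infinity.
\<close>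

lemma subset_if_vertices_of_subset:
  fixes F Q :: "'a::euclidean_space set"
  assumes F: "polyhedron F" "F \<noteq> {}" and Q: "polyhedron Q"
    and face: "F \<inter> Q face_of F" and vert: "vertices_of F \<subseteq> vertices_of Q"
  shows "F \<subseteq> Q"
proof -
  have sub: "R \<subseteq> homog_cone F \<inter> homog_cone Q" if R: "R \<in> vertices_of F" for R
    using vertices_of_imp_subset[OF R] vertices_of_imp_subset[OF subsetD[OF vert R]] by simp
  obtain R y where R: "R \<in> vertices_of F" and y: "y \<in> R" "0 < snd y"
    using ex_finite_vertex[OF F] .
  have "Q \<noteq> {}" using R vert vertices_of_empty by auto
  have "y \<in> homog_cone F" "y \<in> homog_cone Q" using sub[OF R] y(1) by auto
  then have "(1 / snd y) *\<^sub>R fst y \<in> F \<inter> Q"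
    using convex_cone_dehomogenize[OF convex_cone_homog_cone[OF F] _ y(2)]
      convex_cone_dehomogenize[OF convex_cone_homog_cone[OF Q \<open>Q \<noteq> {}\<close>] _ y(2)]
      mem_homog_cone_iff[OF F] mem_homog_cone_iff[OF Q \<open>Q \<noteq> {}\<close>] by simp
  then have ne: "F \<inter> Q \<noteq> {}" by blast
  note K = polyhedron_homog_cone[OF F] convex_cone_homog_cone[OF F]
  have "homog_cone (F \<inter> Q) \<noteq> {}"
    using ne mem_homog_cone_iff[OF face_of_polyhedron_polyhedron[OF F(1) face] ne] by auto
  then have "homog_cone (F \<inter> Q) = homog_cone F"
    using ex_cone_vertex_not_in_face[OF K homog_cone_face_of[OF F(1) face ne]] sub
    unfolding homog_cone_Int[OF F(1) Q ne] vertices_of_def by metis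
  then have "x \<in> F \<Longrightarrow> x \<in> Q" for x
    unfolding homog_cone_Int[OF F(1) Q ne] mem_homog_cone_iff[OF F, symmetric]
      mem_homog_cone_iff[OF Q \<open>Q \<noteq> {}\<close>, symmetric] by auto
  then show ?thesis by blast
qed

section \<open>Polyhedral complexes\<close>

context
  fixes \<P> :: "'a::euclidean_space set set" and lab :: "('a \<times> real) set \<Rightarrow> nat"
  assumes cplx: "polyhedral_complex \<P>"
    and inj: "inj_on lab (\<Union>P\<in>\<P>. vertices_of P)"
begin

lemma cell_face_of:
  assumes "F \<in> \<P>" "P \<in> \<P>" "F \<subseteq> P"
  shows "F face_of P"
proof -
  have "F \<inter> P face_of P" using cplx assms(1,2) unfolding polyhedral_complex_def by simp
  then show ?thesis using assms(3) by (simp add: inf.absorb1)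
qed

text \<open>This makes the vertex sets of earlier cells usable as ignored sets. One direction rests
  on a common finite vertex, the other on the fact that inclusion between cells is a face
  relation.\<close>

lemma label_subset_iff:
  assumes F: "F \<in> \<P>" "F \<noteq> {}" and Q: "Q \<in> \<P>"
  shows "lab ` vertices_of F \<subseteq> lab ` vertices_of Q \<longleftrightarrow> F \<subseteq> Q"
proof -
  have poly: "polyhedron F" "polyhedron Q" and face: "F \<inter> Q face_of F"
    using cplx F Q unfolding polyhedral_complex_def by simp_all
  have "lab ` vertices_of F \<subseteq> lab ` vertices_of Q \<longleftrightarrow> vertices_of F \<subseteq> vertices_of Q"
    using F Q by (intro inj_on_image_subset_iff[OF inj]) auto
  also have "\<dots> \<longleftrightarrow> F \<subseteq> Q"
  proof
    show "F \<subseteq> Q" if "vertices_of F \<subseteq> vertices_of Q"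
      using subset_if_vertices_of_subset[OF poly(1) F(2) poly(2) face that] .
    show "vertices_of F \<subseteq> vertices_of Q" if "F \<subseteq> Q"
      using vertices_of_face[OF poly(2) cell_face_of[OF F(1) Q that]] by simp
  qed
  finally show ?thesis .
qed

lemma label_empty_iff:
  assumes "F \<in> \<P>"
  shows "lab ` vertices_of F = {} \<longleftrightarrow> F = {}"
proof
  assume eq: "lab ` vertices_of F = {}"
  have "polyhedron F" using cplx assms unfolding polyhedral_complex_def by simp
  with eq show "F = {}" by (metis ex_finite_vertex image_is_empty empty_iff)
qed (simp add: vertices_of_empty)

text \<open>Antisymmetry of the inclusion test; the empty cell is recognized separately by its empty
  label set.\<close>

lemma inj_on_label: "inj_on (\<lambda>F. lab ` vertices_of F) \<P>"
proof (rule inj_onI)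
  fix F G assume FG: "F \<in> \<P>" "G \<in> \<P>" and eq: "lab ` vertices_of F = lab ` vertices_of G"
  show "F = G"
  proof (cases "F = {} \<or> G = {}")
    case True
    then show ?thesis using label_empty_iff FG eq by metis
  next
    case False
    then show ?thesis
      using label_subset_iff[OF FG(1) _ FG(2)] label_subset_iff[OF FG(2) _ FG(1)] eq by auto
  qed
qed

section \<open>The iterator on a single cell\<close>

text \<open>\<open>\<Q>\<close> collects the cells already treated. The faces of the cone not at
  infinity account for the nonempty faces of \<open>P\<close>. The empty set lies in every ignored
  set, so it appears only when there is none.\<close>

lemma face_iterator_visits_cell:
  assumes P: "P \<in> \<P>" "P \<noteq> {}" and d: "presents lab P d"
    and V: "set V = (\<lambda>Q. lab ` vertices_of Q) ` \<Q>" and \<Q>: "\<Q> \<subseteq> \<P>" "\<forall>Q\<in>\<Q>. \<not> P \<subseteq> Q"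
    and I: "I = V @ (case cell_marked d of None \<Rightarrow> [] | Some m \<Rightarrow> [m])"
    and C: "C = filter (\<lambda>a. \<forall>y\<in>set I. \<not> a \<subseteq> y) (cell_facets d)"
    and out: "face_iterator C I {} out"
  shows "distinct (cell_vertices d # out)"
    and "set (cell_vertices d # out) =
      {lab ` vertices_of F | F. F \<in> \<P> \<and> F \<noteq> {} \<and> F \<subseteq> P \<and> (\<forall>Q\<in>\<Q>. \<not> F \<subseteq> Q)} \<union>
      (if \<Q> = {} \<and> cell_marked d = None then {{}} else {})"
proof -
  let ?K = "homog_cone P"
  let ?L = "labelled_faces lab ?K"
  let ?X = "?K \<inter> {z. snd z = 0}"
  let ?top = "lab ` cone_vertices ?K"
  let ?ok = "\<lambda>x. \<forall>y\<in>set I. \<not> x \<subseteq> y"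
  have poly: "polyhedron P" using cplx P(1) unfolding polyhedral_complex_def by simp
  note K = polyhedron_homog_cone[OF poly P(2)] convex_cone_homog_cone[OF poly P(2)]
  have injK: "inj_on lab (cone_vertices ?K)"
    using inj_on_subset[OF inj, of "vertices_of P"] P(1) unfolding vertices_of_def by blast
  note sub_iff = labelled_subset_iff[OF K injK]
  have Kf: "?K face_of ?K" "?K \<noteq> {}"
    using K by (auto simp: face_of_refl polyhedron_imp_convex convex_cone_nonempty)
  note X = infinite_part_face_of[OF poly P(2)]
  have Xne: "?X \<noteq> {}" using X(2) by blast
  have top: "cell_vertices d = ?top" using d by (simp add: presents_def vertices_of_def)
  have topL: "?top \<in> ?L" using mem_labelled_faces[OF Kf] .
  \<comment> \<open>The given facets are the coatoms below the top, so the filtered list is a valid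
    start of the iterator.\<close>
  have "set (cell_facets d) = coatoms_below ?L ?top"
    using d unfolding coatoms_below_labelled_faces[OF K injK Kf] by (simp add: presents_def)
  then have setC: "set C = {x \<in> coatoms_below ?L ?top. ?ok x}" unfolding C by simp
  have out': "distinct out" "set out = {x \<in> ?L. x \<subset> ?top \<and> ?ok x}"
    using face_iterator_visits_once[OF out refl finite_labelled_faces[OF K(1)]
        labelled_faces_Int[OF K injK] locally_branched_labelled_faces[OF K injK] topL setC] by simp_all
  show "distinct (cell_vertices d # out)" using out' top by simp

  have homog: "homog_cone F face_of ?K" "homog_cone F \<noteq> {}" "\<not> homog_cone F \<subseteq> ?X" "F \<in> \<P>"
    if F: "F face_of P" "F \<noteq> {}" for F
  proof -
    show "homog_cone F face_of ?K" using homog_cone_face_of[OF poly F] .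
    show "F \<in> \<P>" using cplx P(1) F(1) unfolding polyhedral_complex_def by blast
    obtain p where "p \<in> F" using F(2) by auto
    then have "(p, 1) \<in> homog_cone F"
      using mem_homog_cone_iff[OF face_of_polyhedron_polyhedron[OF poly F(1)] F(2)] by simp
    then show "homog_cone F \<noteq> {}" "\<not> homog_cone F \<subseteq> ?X" by auto
  qed
  have marked: "cell_marked d =
      (if cone_vertices ?X = {} then None else Some (lab ` cone_vertices ?X))"
    using d by (simp add: presents_def vertices_at_infinity_def)
  have okI: "?ok x \<longleftrightarrow> (\<forall>Q\<in>\<Q>. \<not> x \<subseteq> lab ` vertices_of Q) \<and>
      (cone_vertices ?X \<noteq> {} \<longrightarrow> \<not> x \<subseteq> lab ` cone_vertices ?X)" for x
    unfolding I marked using V by auto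
  have ok: "?ok (lab ` vertices_of F) \<longleftrightarrow> (\<forall>Q\<in>\<Q>. \<not> F \<subseteq> Q)"
    if F: "F face_of P" "F \<noteq> {}" for F
  proof -
    \<comment> \<open>A nonempty face of \<open>P\<close> has a finite point, so the marked face
      never hides it.\<close>
    have "\<not> lab ` vertices_of F \<subseteq> lab ` cone_vertices ?X"
      unfolding vertices_of_def sub_iff[OF homog(1,2)[OF F] X(1) Xne] by (rule homog(3)[OF F])
    moreover have "lab ` vertices_of F \<subseteq> lab ` vertices_of Q \<longleftrightarrow> F \<subseteq> Q" if "Q \<in> \<Q>" for Q
      using label_subset_iff[OF homog(4)[OF F] F(2)] that \<Q>(1) by blast
    ultimately show ?thesis unfolding okI by simp
  qed
  have ok_empty: "?ok {} \<longleftrightarrow> \<Q> = {} \<and> cell_marked d = None"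
    unfolding okI marked by auto
  have empty: "{} \<in> ?L"
    using mem_labelled_faces[OF lineality_space_face_of[OF K(2)]] zero_mem_lineality_space[OF K(2)]
      cone_vertices_lineality_space[OF K(2)] by (metis empty_iff image_empty)
  have "set (cell_vertices d # out) = {x \<in> ?L. ?ok x}"
  proof -
    \<comment> \<open>No treated cell contains \<open>P\<close>, so the top is not ignored and joins
      the elements strictly below it.\<close>
    have "?ok ?top"
      using ok[of P] \<Q>(2) P(2) face_of_refl[OF polyhedron_imp_convex[OF poly]]
      by (simp add: vertices_of_def)
    moreover have "x \<subseteq> ?top" if "x \<in> ?L" for x
      using that sub_iff[OF _ _ Kf] by (auto simp: labelled_faces_def dest: face_of_imp_subset)
    ultimately show ?thesis unfolding top using out'(2) topL by auto
  qed
  also have "\<dots> = {lab ` vertices_of F | F. F face_of P \<and> F \<noteq> {} \<and> (\<forall>Q\<in>\<Q>. \<not> F \<subseteq> Q)} \<union>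
      (if \<Q> = {} \<and> cell_marked d = None then {{}} else {})" (is "_ = ?A \<union> ?B")
  proof (intro equalityI subsetI)
    fix x assume x: "x \<in> {x \<in> ?L. ?ok x}"
    then obtain G where G: "G face_of ?K" "G \<noteq> {}" and xG: "x = lab ` cone_vertices G"
      by (auto simp: labelled_faces_def)
    show "x \<in> ?A \<union> ?B"
    proof (cases "G \<subseteq> ?X")
      case True
      \<comment> \<open>If the part at infinity has vertices, it is the marked face and would hide
        \<open>x\<close>; otherwise \<open>x\<close> is empty.\<close>
      then have "x \<subseteq> lab ` cone_vertices ?X" using sub_iff[OF G X(1) Xne] xG by simp
      then have "x = {}" using x okI[of x] by auto
      then show ?thesis using x ok_empty by simp
    next
      case False
      then obtain y where y: "y \<in> G" "snd y \<noteq> 0" using face_of_imp_subset[OF G(1)] by auto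
      then have "0 < snd y"
        using snd_homog_cone_nonneg[OF poly P(2), of y] face_of_imp_subset[OF G(1)] by auto
      from face_of_homog_coneE[OF poly P(2) G(1) y(1) this]
      obtain F where F: "F face_of P" "F \<noteq> {}" "G = homog_cone F" .
      then show ?thesis using x ok[OF F(1,2)] xG by (auto simp: vertices_of_def)
    qed
  next
    fix x assume "x \<in> ?A \<union> ?B"
    then show "x \<in> {x \<in> ?L. ?ok x}"
    proof
      assume "x \<in> ?A"
      then obtain F where F: "F face_of P" "F \<noteq> {}" and x: "x = lab ` vertices_of F"
        and "\<forall>Q\<in>\<Q>. \<not> F \<subseteq> Q" by auto
      then have "?ok x" using ok[OF F] by simp
      moreover have "x \<in> ?L"
        unfolding x vertices_of_def using homog(1,2)[OF F] by (rule mem_labelled_faces)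
      ultimately show ?thesis by simp
    next
      assume "x \<in> ?B"
      then have "x = {}" "\<Q> = {} \<and> cell_marked d = None" by (auto split: if_splits)
      then show ?thesis using ok_empty empty by simp
    qed
  qed
  also have "?A = {lab ` vertices_of F | F. F \<in> \<P> \<and> F \<noteq> {} \<and> F \<subseteq> P \<and> (\<forall>Q\<in>\<Q>. \<not> F \<subseteq> Q)}"
  proof -
    have "F face_of P \<longleftrightarrow> F \<in> \<P> \<and> F \<subseteq> P" if "F \<noteq> {}" for F
      using cell_face_of[OF _ P(1), of F] homog(4)[OF _ that] face_of_imp_subset[of F P] by blast
    then show ?thesis by (intro Collect_cong ex_cong1) auto
  qed
  finally show "set (cell_vertices d # out) = \<dots> \<union> ?B" .
qed

section \<open>Successive application to several cells\<close>

text \<open>Induction over the cells, \<open>\<Q>\<close> growing by each treated cell. Maximality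
  keeps a new cell from lying in a treated one. After the first cell \<open>\<Q>\<close> is
  nonempty, so the empty set can come only from the first cell.\<close>

lemma visit_cells_once:
  assumes "visit_cells V ds out" "list_all2 (presents lab) Ps ds"
    and "set V = (\<lambda>Q. lab ` vertices_of Q) ` \<Q>" "\<Q> \<subseteq> \<P>" "set Ps \<subseteq> \<P>" "{} \<notin> set Ps" "distinct Ps"
    and "\<And>P Q. P \<in> set Ps \<Longrightarrow> Q \<in> \<Q> \<union> set Ps \<Longrightarrow> P \<subseteq> Q \<Longrightarrow> Q = P" "\<Q> \<inter> set Ps = {}"
  shows "distinct out \<and> set out =
      {lab ` vertices_of F | F. F \<in> \<P> \<and> F \<noteq> {} \<and> (\<exists>P\<in>set Ps. F \<subseteq> P) \<and> (\<forall>Q\<in>\<Q>. \<not> F \<subseteq> Q)} \<union>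
      (if \<Q> = {} \<and> ds \<noteq> [] \<and> cell_marked (hd ds) = None then {{}} else {})"
  using assms
proof (induction arbitrary: Ps \<Q> rule: visit_cells.induct)
  case (nil V)
  then show ?case by simp
next
  case (cons I V d C out1 ds out2)
  obtain P Ps' where Ps: "Ps = P # Ps'" and d: "presents lab P d" "list_all2 (presents lab) Ps' ds"
    using cons.prems(1) by (auto simp: list_all2_Cons2)
  have P: "P \<in> \<P>" "P \<noteq> {}" using cons.prems(4,5) Ps by auto
  have notin: "P \<notin> \<Q>" "P \<notin> set Ps'" using cons.prems(6,8) Ps by auto
  have notsub: "\<forall>Q\<in>\<Q>. \<not> P \<subseteq> Q"
    using cons.prems(7)[of P] notin(1) Ps by auto
  note 1 = face_iterator_visits_cell[OF P d(1) cons.prems(2,3) notsub cons.hyps(1,2,3)]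
  have "set (V @ [cell_vertices d]) = (\<lambda>Q. lab ` vertices_of Q) ` insert P \<Q>"
    using cons.prems(2) d(1) by (simp add: presents_def)
  moreover have "insert P \<Q> \<subseteq> \<P>" "set Ps' \<subseteq> \<P>" "{} \<notin> set Ps'" "distinct Ps'" "insert P \<Q> \<inter> set Ps' = {}"
    using cons.prems(3-6,8) P notin Ps by auto
  moreover have "Q = R" if "R \<in> set Ps'" "Q \<in> insert P \<Q> \<union> set Ps'" "R \<subseteq> Q" for R Q
    using cons.prems(7)[of R Q] that Ps by auto
  ultimately have 2: "distinct out2" "set out2 = {lab ` vertices_of F | F. F \<in> \<P> \<and> F \<noteq> {} \<and>
      (\<exists>P\<in>set Ps'. F \<subseteq> P) \<and> (\<forall>Q\<in>insert P \<Q>. \<not> F \<subseteq> Q)}"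
    using cons.IH[OF d(2), of "insert P \<Q>"] by simp_all
  \<comment> \<open>Labels in \<open>out2\<close> belong to nonempty faces not contained in
    \<open>P\<close>, those of the current cell to faces inside \<open>P\<close> or to the empty
    face; injectivity of the labelling separates them.\<close>
  have "set (cell_vertices d # out1) \<inter> set out2 = {}"
  proof (rule ccontr)
    assume "set (cell_vertices d # out1) \<inter> set out2 \<noteq> {}"
    then obtain x where x: "x \<in> set (cell_vertices d # out1)" "x \<in> set out2" by blast
    obtain F where F: "x = lab ` vertices_of F" "F \<in> \<P>" "F \<noteq> {}" "\<not> F \<subseteq> P"
      using x(2) unfolding 2(2) by blast
    have "x \<noteq> {}" using label_empty_iff F by simp
    then obtain G where "x = lab ` vertices_of G" "G \<in> \<P>" "G \<subseteq> P"
      using subsetD[OF equalityD1[OF 1(2)] x(1)] by (auto split: if_splits)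
    then show False using F inj_onD[OF inj_on_label, of F G] by simp
  qed
  moreover have "set (cell_vertices d # out1) \<union> set out2 =
      {lab ` vertices_of F | F. F \<in> \<P> \<and> F \<noteq> {} \<and> (\<exists>P\<in>set Ps. F \<subseteq> P) \<and> (\<forall>Q\<in>\<Q>. \<not> F \<subseteq> Q)} \<union>
      (if \<Q> = {} \<and> d # ds \<noteq> [] \<and> cell_marked (hd (d # ds)) = None then {{}} else {})"
  proof -
    \<comment> \<open>A face not yet visited is met at \<open>P\<close> if it lies in
      \<open>P\<close>, and in a later cell otherwise.\<close>
    have "{F. F \<in> \<P> \<and> F \<noteq> {} \<and> (\<exists>P\<in>set Ps. F \<subseteq> P) \<and> (\<forall>Q\<in>\<Q>. \<not> F \<subseteq> Q)} =
        {F. F \<in> \<P> \<and> F \<noteq> {} \<and> F \<subseteq> P \<and> (\<forall>Q\<in>\<Q>. \<not> F \<subseteq> Q)} \<union>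
        {F. F \<in> \<P> \<and> F \<noteq> {} \<and> (\<exists>P\<in>set Ps'. F \<subseteq> P) \<and> (\<forall>Q\<in>insert P \<Q>. \<not> F \<subseteq> Q)}"
      unfolding Ps by auto
    then show ?thesis
      unfolding 1(2) 2(2) setcompr_eq_image by (simp add: image_Un Un_ac del: ball_simps)
  qed
  ultimately show ?case using 1(1) 2(1) by auto
qed

end

section \<open>The whole complex\<close>

lemma count_list_distinct: "distinct xs \<Longrightarrow> x \<in> set xs \<Longrightarrow> count_list xs x = 1"
  by (induction xs) (auto simp: count_list_0_iff)

text \<open>The homogenization of the empty polyhedron is empty, hence no convex cone, so this case
  is treated directly: there are no facets and no marked face, and only the upper bound is
  visited.\<close>

lemma visit_complex_empty_cell:
  assumes "presents lab {} d" "visit_complex [d] out"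
  shows "out = [{}]"
proof -
  have K: "homog_cone {} = {}" by (simp add: homog_cone_def cone_hull_empty)
  have d: "cell_vertices d = {}" "cell_facets d = []" "cell_marked d = None"
    using assms(1) unfolding presents_def vertices_of_def vertices_at_infinity_def K
    by (auto simp: cone_vertices_def lineality_space_def)
  obtain out' where out': "visit_cells [] [d] out'" and out: "out = out'"
    using assms(2) d(3) by (auto simp: visit_complex_def)
  from out' show ?thesis
    unfolding out by (cases rule: visit_cells.cases)
      (auto simp: d elim: visit_cells.cases face_iterator.cases)
qed

theorem corollary3p12:
  fixes \<P> :: "'a::euclidean_space set set"
    and Ps :: "'a set list"
    and ds :: "cell_data list"
    and lab :: "('a \<times> real) set \<Rightarrow> nat"
    and n :: nat
  assumes "polyhedral_complex \<P>" and "finite \<P>"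
    and "distinct Ps" and "set Ps = maximal_cells \<P>"
    and "inj_on lab (\<Union>P\<in>\<P>. vertices_of P)"
    and "lab ` (\<Union>P\<in>\<P>. vertices_of P) \<subseteq> {1..n}"
    and "list_all2 (presents lab) Ps ds"
  shows "(\<exists>out. visit_complex ds out) \<and>
    (\<forall>out. visit_complex ds out \<longrightarrow>
       bij_betw (\<lambda>F. lab ` vertices_of F) \<P> (set out) \<and>
       (\<forall>F\<in>\<P>. count_list out (lab ` vertices_of F) = 1))"
proof (intro conjI allI impI)
  show "\<exists>out. visit_complex ds out"
    using ex_visit_cells unfolding visit_complex_def by blast
  let ?label = "\<lambda>F. lab ` vertices_of F"
  fix out assume out: "visit_complex ds out"
  have max: "P \<in> \<P>" "\<And>Q. Q \<in> \<P> \<Longrightarrow> P \<subseteq> Q \<Longrightarrow> Q = P" if "P \<in> set Ps" for P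
    using that assms(4) unfolding maximal_cells_def by simp_all
  have ex_max: "\<exists>P\<in>set Ps. F \<subseteq> P" if F: "F \<in> \<P>" for F
  proof -
    obtain P where "P \<in> \<P>" "F \<subseteq> P" "\<forall>Q\<in>\<P>. P \<subseteq> Q \<longrightarrow> P = Q"
      using finite_has_maximal2[OF assms(2) F] by (elim bexE conjE)
    then show ?thesis unfolding assms(4) maximal_cells_def by auto
  qed
  have "distinct out \<and> set out = ?label ` \<P>"
  proof (cases "{} \<in> set Ps")
    case True
    \<comment> \<open>The empty cell lies in every cell, so it is maximal only if it is the only
      one.\<close>
    then have "set Ps = {{}}" "\<P> = {{}}"
      using max(2)[OF True] max(1) ex_max by auto
    then have "Ps = [{}]"
      using assms(3) by (cases Ps; cases "tl Ps") auto
    then obtain d where "ds = [d]" "presents lab {} d"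
      using assms(7) by (auto simp: list_all2_Cons1)
    then have "out = [{}]" using visit_complex_empty_cell out by blast
    then show ?thesis using \<open>\<P> = {{}}\<close> by (simp add: vertices_of_empty)
  next
    case False
    obtain out' where out': "visit_cells [] ds out'"
      and eq: "out = out' @ (if ds \<noteq> [] \<and> cell_marked (hd ds) \<noteq> None then [{}] else [])"
      using out unfolding visit_complex_def by blast
    have "set Ps \<subseteq> \<P>" using max(1) by blast
    then have *: "distinct out'" "set out' =
      {?label F | F. F \<in> \<P> \<and> F \<noteq> {} \<and> (\<exists>P\<in>set Ps. F \<subseteq> P)} \<union>
      (if ds \<noteq> [] \<and> cell_marked (hd ds) = None then {{}} else {})"
      using visit_cells_once[OF assms(1,5) out' assms(7), of "{}"] max False assms(3) by auto
    have "{?label F | F. F \<in> \<P> \<and> F \<noteq> {} \<and> (\<exists>P\<in>set Ps. F \<subseteq> P)} = ?label ` (\<P> - {{}})"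
      using ex_max by auto
    note set_out' = *(2)[unfolded this]
    have notin: "{} \<notin> ?label ` (\<P> - {{}})"
      using label_empty_iff[OF assms(1,5)] by blast
    have len: "length Ps = length ds" using assms(7) by (rule list_all2_lengthD)
    show ?thesis
    proof (cases "ds = []")
      case True
      \<comment> \<open>Every cell lies in a maximal one, so without maximal cells there are no
        cells.\<close>
      then have "\<P> = {}" using len ex_max by auto
      then show ?thesis using *(1) set_out' eq True by simp
    next
      case False
      then obtain P where "P \<in> \<P>" using len max(1) by (cases Ps) auto
      then have "{} \<in> \<P>" using assms(1) unfolding polyhedral_complex_def by blast
      have "?label ` \<P> = insert {} (?label ` (\<P> - {{}}))"
        using image_insert[of ?label "{}" "\<P> - {{}}"]
        unfolding insert_Diff[OF \<open>{} \<in> \<P>\<close>] vertices_of_empty image_empty .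
      \<comment> \<open>The empty face is output with the first cell if that has no marked face, and
        is appended at the end otherwise; either way it occurs once.\<close>
      then show ?thesis
        using *(1) set_out' eq False notin by (cases "cell_marked (hd ds) = None") auto
    qed
  qed
  then show "bij_betw ?label \<P> (set out)" "\<forall>F\<in>\<P>. count_list out (?label F) = 1"
    using inj_on_label[OF assms(1,5)]
    by (auto simp: bij_betw_def count_list_distinct simp del: One_nat_def)
qed

end
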